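(* Let $n\ge1$ with $n\equiv0,\pm1\bmod8$, let $(W,\rho)$ be a finite-dimensional complex representation of $\mathrm{SO}_n(\mathbb{R})$, and let $A$ be a finite abelian group. Let $L_1,\dots,L_h$ be representatives of the classes of $\widetilde X_n=\mathrm{SO}_n(\mathbb{R})\backslash\mathcal{L}_n$. For $i\in\{1,\dots,h\}$ let $\mathrm{vois}_A(L_i)$ be the set of $A$-neighbours of $L_i$ and let $\mathcal{V}_i\subset\mathrm{vois}_A(L_i)$ be the subset of those $A$-neighbours that are isomorphic to $L_i$, i.e. of the form $gL_i$ with $g\in\mathrm{SO}_n(\mathbb{R})$. The set $\mathcal{V}_i$ is stable under $\mathrm{SO}(L_i)$; write it as the disjoint union of its $\mathrm{SO}(L_i)$-orbits $$\mathcal{V}_i=\coprod_{j\in J_i}\mathrm{SO}(L_i)\,g_{i,j}L_i=\coprod_{j\in J_i}\mathcal{V}_{i,j},$$ where $g_{i,j}\in\mathrm{SO}_n(\mathbb{R})$ and $\mathcal{V}_{i,j}$ is the orbit containing $g_{i,j}L_i$. Then $$\mathrm{tr}\left(\mathrm{T}_A\,|\,\mathcal{M}_W(\mathrm{SO}_n)\right)=\sum_{i=1}^h\frac{1}{|\mathrm{SO}(L_i)|}\left(\sum_{j\in J_i}|\mathcal{V}_{i,j}|\cdot\sum_{\gamma\in\mathrm{SO}(L_i)}\mathrm{tr}(\gamma g_{i,j}\,|\,W)\right).$$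
   Context: $\mathbb{R}^n$ carries its usual inner product. For $n\equiv 0,\pm1\bmod 8$, $\mathcal{L}_n$ is the set of even lattices $L\subset\mathbb{R}^n$ (i.e. $x\cdot y\in\mathbb{Z}$ and $x\cdot x\in2\mathbb{Z}$ for $x,y\in L$) with $\det(L)=1$ if $n$ is even and $\det(L)=2$ if $n$ is odd. The set $\mathrm{SO}_n(\mathbb{R})\backslash\mathcal{L}_n$ is finite. For $L\in\mathcal{L}_n$, $\mathrm{SO}(L)=\{g\in\mathrm{SO}_n(\mathbb{R}): gL=L\}$, a finite group. For a finite abelian group $A$, two lattices $L,L'\in\mathcal{L}_n$ are $A$-neighbours if $L/(L\cap L')\simeq L'/(L\cap L')\simeq A$. For a finite-dimensional complex representation $(W,\rho)$ of $\mathrm{SO}_n(\mathbb{R})$, $\mathcal{M}_W(\mathrm{SO}_n)$ is the finite-dimensional space of functions $f:\mathcal{L}_n\to W$ with $f(\gamma L)=\rho(\gamma)f(L)$ for all $\gamma\in\mathrm{SO}_n(\mathbb{R})$ and $L\in\mathcal{L}_n$. The Hecke operator $\mathrm{T}_A$ acts on it by $\mathrm{T}_A(f)(L)=\sum_{L'} f(L')$, the sum being over all $A$-neighbours $L'$ of $L$. *)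

theory Defs
  imports
    "HOL-Analysis.Analysis"
    "HOL-Algebra.Coset"
    "HOL-Library.Function_Algebras"
begin

text \<open>
  The trace is read off the diagonal coefficients in a basis of \<open>V\<close>. It is meaningful when \<open>V\<close> is a
  finite-dimensional subspace and \<open>T\<close> restricts to a linear map \<open>V \<rightarrow> V\<close>; it is then independent of the
  chosen basis. Taking \<open>V = UNIV\<close> gives the trace on the whole space.
\<close>

context vector_space
begin

definition trace_on :: "'b set \<Rightarrow> ('b \<Rightarrow> 'b) \<Rightarrow> 'a" where
  "trace_on V T =
     (let B = (SOME B. B \<subseteq> V \<and> independent B \<and> span B = V)
      in \<Sum>b\<in>B. representation B (T b) b)"

end

definition lattice_basis :: "('n::finite \<Rightarrow> real ^ 'n) \<Rightarrow> (real ^ 'n) set \<Rightarrow> bool" where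
  "lattice_basis b L \<longleftrightarrow>
     inj b \<and> independent (range b) \<and>
     L = range (\<lambda>c :: 'n \<Rightarrow> int. \<Sum>i\<in>UNIV. of_int (c i) *\<^sub>R b i)"

definition euclidean_lattice :: "(real ^ 'n::finite) set \<Rightarrow> bool" where
  "euclidean_lattice L \<longleftrightarrow> (\<exists>b. lattice_basis b L)"

definition gram_matrix :: "('n::finite \<Rightarrow> real ^ 'n) \<Rightarrow> real ^ 'n ^ 'n" where
  "gram_matrix b = (\<chi> i j. b i \<bullet> b j)"

definition lattice_det :: "(real ^ 'n::finite) set \<Rightarrow> real" where
  "lattice_det L = (THE d. \<exists>b. lattice_basis b L \<and> d = det (gram_matrix b))"

definition even_lattice :: "(real ^ 'n::finite) set \<Rightarrow> bool" where
  "even_lattice L \<longleftrightarrow>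
     euclidean_lattice L \<and> (\<forall>x\<in>L. \<forall>y\<in>L. x \<bullet> y \<in> \<int>) \<and> (\<forall>x\<in>L. \<exists>k :: int. x \<bullet> x = 2 * of_int k)"

definition even_lattices :: "(real ^ 'n::finite) set set" where
  "even_lattices =
     {L. even_lattice L \<and> lattice_det L = (if even CARD('n) then 1 else 2)}"

lemma gram_matrix_conv: "gram_matrix b = (\<chi> i. b i) ** transpose (\<chi> i. b i)"
  by (simp add: gram_matrix_def matrix_matrix_mult_def transpose_def vec_eq_iff inner_vec_def)

lemma det_gram_matrix: "det (gram_matrix b) = (det (\<chi> i. b i))\<^sup>2"
  by (simp add: gram_matrix_conv det_mul power2_eq_square)

lemma det_in_Ints:
  fixes C :: "real ^ 'n::finite ^ 'n"
  assumes "\<And>i j. C $ i $ j \<in> \<int>"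
  shows "det C \<in> \<int>"
  unfolding det_def by (intro Ints_sum Ints_mult Ints_prod Ints_of_int assms)

lemma lattice_basis_change:
  assumes b: "lattice_basis b L" and b': "lattice_basis b' L"
  obtains k :: int where "det (\<chi> i. b' i) = of_int k * det (\<chi> i. b i)"
proof -
  have "b' i \<in> L" for i
  proof -
    have "b' i = (\<Sum>j\<in>UNIV. of_int (if j = i then 1 else 0) *\<^sub>R b' j)"
      by (simp add: if_distrib if_distribR sum.delta cong: if_cong)
    then have "b' i \<in> range (\<lambda>c :: 'a \<Rightarrow> int. \<Sum>j\<in>UNIV. of_int (c j) *\<^sub>R b' j)"
      by (rule range_eqI[where x = "\<lambda>j. if j = i then 1 else 0"])
    then show ?thesis using b' by (simp add: lattice_basis_def)
  qed
  then have "\<forall>i. \<exists>c :: _ \<Rightarrow> int. b' i = (\<Sum>j\<in>UNIV. of_int (c j) *\<^sub>R b j)"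
    using b unfolding lattice_basis_def by blast
  then obtain c :: "'a \<Rightarrow> 'a \<Rightarrow> int"
    where c: "\<And>i. b' i = (\<Sum>j\<in>UNIV. of_int (c i j) *\<^sub>R b j)" by metis
  define C :: "real ^ 'a ^ 'a" where "C = (\<chi> i j. of_int (c i j))"
  have C: "(\<chi> i. b' i) = C ** (\<chi> i. b i)"
    by (simp add: C_def c matrix_matrix_mult_def vec_eq_iff)
  have "det C \<in> \<int>"
    by (rule det_in_Ints) (simp add: C_def)
  then obtain k where "det C = of_int k"
    by (rule Ints_cases)
  with C show ?thesis
    using that by (simp only: det_mul)
qed

lemma lattice_basis_det_nonzero:
  assumes "lattice_basis b L"
  shows "det (\<chi> i. b i) \<noteq> 0"
proof
  assume "det (\<chi> i. b i) = 0"
  then have "\<nexists>B. (\<chi> i. b i) ** B = mat 1"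
    using invertible_det_nz[of "\<chi> i. b i"] invertible_right_inverse[of "\<chi> i. b i"] by blast
  then obtain d i where d: "(\<Sum>i\<in>UNIV. d i *s row i (\<chi> i. b i)) = 0" "d i \<noteq> 0"
    unfolding matrix_right_invertible_independent_rows by blast
  have b: "inj b" "independent (range b)"
    using assms by (auto simp: lattice_basis_def)
  have "(\<Sum>v\<in>range b. d (the_inv b v) *\<^sub>R v) = (\<Sum>i\<in>UNIV. d i *\<^sub>R b i)"
    using b by (simp add: sum.reindex the_inv_f_f)
  also have "\<dots> = 0"
    using d by (simp add: row_def scalar_mult_eq_scaleR vec_eq_iff)
  finally have "d (the_inv b (b i)) = 0"
    using b by (intro independentD[OF b(2), of "range b" "\<lambda>v. d (the_inv b v)"]) auto
  with d b show False by (simp add: the_inv_f_f)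
qed

lemma lattice_det_eq:
  assumes b: "lattice_basis b L"
  shows "lattice_det L = det (gram_matrix b)"
proof -
  have "det (gram_matrix b') = det (gram_matrix b)" if b': "lattice_basis b' L" for b'
  proof -
    obtain k :: int where k: "det (\<chi> i. b' i) = of_int k * det (\<chi> i. b i)"
      by (rule lattice_basis_change[OF b b'])
    obtain l :: int where l: "det (\<chi> i. b i) = of_int l * det (\<chi> i. b' i)"
      by (rule lattice_basis_change[OF b' b])
    let ?d = "det (\<chi> i. b i)"
    have "real_of_int (k * l) * ?d = of_int l * (of_int k * ?d)"
      by (simp only: of_int_mult mult_ac)
    also have "\<dots> = 1 * ?d"
      by (simp only: k[symmetric] l[symmetric] mult_1_left)
    finally have "real_of_int (k * l) = 1"
      using lattice_basis_det_nonzero[OF b] by (simp only: mult_cancel_right simp_thms)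
    then have "k * l = 1"
      by (simp only: of_int_eq_1_iff)
    then have "k = 1 \<or> k = -1"
      by (simp only: zmult_eq_1_iff) blast
    then have "(of_int k :: real)\<^sup>2 = 1"
      by (elim disjE) simp_all
    then show ?thesis
      by (simp only: det_gram_matrix k power_mult_distrib mult_1_left)
  qed
  with b show ?thesis
    unfolding lattice_det_def by (intro the_equality) blast+
qed

definition SO :: "(real ^ 'n::finite ^ 'n) set" where
  "SO = {g. rotation_matrix g}"

definition act :: "real ^ 'n::finite ^ 'n \<Rightarrow> (real ^ 'n) set \<Rightarrow> (real ^ 'n) set" where
  "act g L = (\<lambda>x. g *v x) ` L"

definition SO_stab :: "(real ^ 'n::finite) set \<Rightarrow> (real ^ 'n ^ 'n) set" where
  "SO_stab L = {g \<in> SO. act g L = L}"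

definition SO_class :: "(real ^ 'n::finite) set \<Rightarrow> (real ^ 'n) set set" where
  "SO_class L = {act g L |g. g \<in> SO}"

definition lattice_classes :: "(real ^ 'n::finite) set set set" where
  "lattice_classes = SO_class ` even_lattices"

definition SO_stab_orbit ::
  "(real ^ 'n::finite) set \<Rightarrow> (real ^ 'n) set \<Rightarrow> (real ^ 'n) set set" where
  "SO_stab_orbit L M = {act \<gamma> M |\<gamma>. \<gamma> \<in> SO_stab L}"

definition additive_group :: "'v::ab_group_add set \<Rightarrow> 'v monoid" where
  "additive_group L = \<lparr>carrier = L, monoid.mult = (+), one = 0\<rparr>"

definition neighbours ::
  "'a monoid \<Rightarrow> (real ^ 'n::finite) set \<Rightarrow> (real ^ 'n) set set" where
  "neighbours A L =
     {L' \<in> even_lattices.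
        (additive_group L Mod (L \<inter> L')) \<cong> A \<and> (additive_group L' Mod (L \<inter> L')) \<cong> A}"

definition isometric_neighbours ::
  "'a monoid \<Rightarrow> (real ^ 'n::finite) set \<Rightarrow> (real ^ 'n) set set" where
  "isometric_neighbours A L = {L' \<in> neighbours A L. \<exists>g\<in>SO. L' = act g L}"

text \<open>
  The representation space \<open>W\<close> is the whole type \<open>'w\<close> with scalar multiplication \<open>sc\<close>; only the
  values of \<open>\<rho>\<close> on \<^const>\<open>SO\<close> matter.
\<close>

definition SO_representation ::
  "(complex \<Rightarrow> 'w::ab_group_add \<Rightarrow> 'w) \<Rightarrow> (real ^ 'n::finite ^ 'n \<Rightarrow> 'w \<Rightarrow> 'w) \<Rightarrow> bool" where
  "SO_representation sc \<rho> \<longleftrightarrow>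
     (\<forall>g\<in>SO. Vector_Spaces.linear sc sc (\<rho> g)) \<and>
     \<rho> (mat 1) = id \<and>
     (\<forall>g\<in>SO. \<forall>h\<in>SO. \<rho> (g ** h) = \<rho> g \<circ> \<rho> h)"

definition fun_scale :: "('k \<Rightarrow> 'w \<Rightarrow> 'w) \<Rightarrow> 'k \<Rightarrow> ('x \<Rightarrow> 'w) \<Rightarrow> 'x \<Rightarrow> 'w" where
  "fun_scale sc c f = (\<lambda>x. sc c (f x))"

lemma vector_space_fun_scale: "vector_space sc \<Longrightarrow> vector_space (fun_scale sc)"
  by (simp add: vector_space_def fun_scale_def fun_eq_iff)

text \<open>
  A function on \<^const>\<open>even_lattices\<close> is represented by its extension by zero to all subsets of the
  ambient space, so that equality of such functions is equality in HOL.
\<close>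

definition automorphic_forms ::
  "(real ^ 'n::finite ^ 'n \<Rightarrow> 'w::ab_group_add \<Rightarrow> 'w) \<Rightarrow> ((real ^ 'n) set \<Rightarrow> 'w) set" where
  "automorphic_forms \<rho> =
     {f. (\<forall>\<gamma>\<in>SO. \<forall>L\<in>even_lattices. f (act \<gamma> L) = \<rho> \<gamma> (f L)) \<and>
         (\<forall>L. L \<notin> even_lattices \<longrightarrow> f L = 0)}"

definition hecke ::
  "'a monoid \<Rightarrow> ((real ^ 'n::finite) set \<Rightarrow> 'w::ab_group_add) \<Rightarrow> (real ^ 'n) set \<Rightarrow> 'w" where
  "hecke A f L = (if L \<in> even_lattices then \<Sum>L'\<in>neighbours A L. f L' else 0)"

end

theory Submission
  imports Defs "HOL-Algebra.Multiplicative_Group"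
begin

text \<open>
  Let \<open>\<iota>\<^sub>i f = f L\<^sub>i\<close>, and let \<open>\<pi>\<^sub>i w\<close> be the form supported on the class of \<open>L\<^sub>i\<close> whose value at
  \<open>L\<^sub>i\<close> is the projection of \<open>w\<close> to the \<open>SO(L\<^sub>i)\<close>-invariants. Then \<open>\<Sum>\<^sub>i \<pi>\<^sub>i \<iota>\<^sub>i\<close> is the identity on
  automorphic forms, so by cyclicity the trace of \<open>T\<close> is the sum of the traces of \<open>\<iota>\<^sub>i T \<pi>\<^sub>i\<close> on the
  whole of \<open>W\<close>; no basis of the invariants is needed. A neighbour \<open>\<delta> g L\<^sub>i\<close> with
  \<open>\<delta> \<in> SO(L\<^sub>i)\<close> contributes to \<open>\<iota>\<^sub>i T \<pi>\<^sub>i\<close> the average of \<open>\<rho>(\<delta> g \<gamma>)\<close> over \<open>\<gamma> \<in> SO(L\<^sub>i)\<close>, whose trace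
  is that of the average of \<open>\<rho>(\<gamma> g)\<close>, again by cyclicity.
\<close>

section \<open>Traces on finite-dimensional subspaces\<close>

context vector_space
begin

text \<open>Opens the choice inside \<open>trace_on\<close> once. The chosen basis depends on
  \<open>V\<close> alone, so one \<open>B\<close> serves all \<open>T\<close> and traces of
  different maps can be compared. Its finiteness comes from \<open>F\<close>, since the ambient
  space may have infinite dimension.\<close>

lemma trace_on_basis:
  assumes "subspace V" "finite F" "V \<subseteq> span F"
  obtains B where "finite B" "B \<subseteq> V" "independent B" "span B = V"
    and "\<And>T. trace_on V T = (\<Sum>b\<in>B. representation B (T b) b)"
proof -
  let ?P = "\<lambda>B. B \<subseteq> V \<and> independent B \<and> span B = V"
  define B where "B = (SOME B. ?P B)"
  obtain B' where "B' \<subseteq> V" "independent B'" "V \<subseteq> span B'"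
    using maximal_independent_subset by blast
  then have "?P B'"
    using span_minimal[OF _ assms(1)] by blast
  then have B: "?P B"
    unfolding B_def by (rule someI)
  moreover have "finite B"
    using independent_span_bound[OF assms(2), of B] B assms(3) by blast
  moreover have "trace_on V T = (\<Sum>b\<in>B. representation B (T b) b)" for T
    by (simp add: trace_on_def B_def Let_def)
  ultimately show ?thesis
    using that by blast
qed

text \<open>Coordinates in a fixed basis are linear in the vector, and the diagonal coefficients see
  the maps only at basis vectors; hence the identity for \<open>T\<close> is asked on
  \<open>V\<close> alone. For empty \<open>I\<close> this says that the zero map has trace
  0.\<close>

lemma trace_on_sum_scale:
  assumes "subspace V" "finite F" "V \<subseteq> span F"
    and T: "\<And>x. x \<in> V \<Longrightarrow> T x = (\<Sum>i\<in>I. scale (c i) (S i x))"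
    and S: "\<And>i x. i \<in> I \<Longrightarrow> x \<in> V \<Longrightarrow> S i x \<in> V"
  shows "trace_on V T = (\<Sum>i\<in>I. c i * trace_on V (S i))"
proof -
  obtain B where B: "finite B" "B \<subseteq> V" "independent B" "span B = V"
    and tr: "\<And>T. trace_on V T = (\<Sum>b\<in>B. representation B (T b) b)"
    using trace_on_basis[OF assms(1-3)] by blast
  have "representation B (T b) b = (\<Sum>i\<in>I. c i * representation B (S i b) b)" if "b \<in> B" for b
  proof -
    have b: "b \<in> V" using B that by blast
    then have "S i b \<in> span B" if "i \<in> I" for i
      using S B that by blast
    then show ?thesis
      by (simp add: T[OF b] representation_sum[OF B(3)] representation_scale[OF B(3)] span_scale)
  qed
  then have "trace_on V T = (\<Sum>b\<in>B. \<Sum>i\<in>I. c i * representation B (S i b) b)"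
    by (simp add: tr)
  also have "\<dots> = (\<Sum>i\<in>I. c i * trace_on V (S i))"
    by (subst sum.swap) (simp add: tr sum_distrib_left)
  finally show ?thesis .
qed

end

text \<open>In bases of \<open>V\<close> and \<open>U\<close> both traces are the double sum of
  products of the matrix entries of \<open>f\<close> and \<open>g\<close>, in the two orders of
  summation. The two spaces may differ, which allows a trace on automorphic forms to be moved to
  \<open>W\<close>.\<close>

lemma (in vector_space_pair) trace_on_cyclic:
  assumes f: "Vector_Spaces.linear s1 s2 f" "f ` V \<subseteq> U" and g: "Vector_Spaces.linear s2 s1 g" "g ` U \<subseteq> V"
    and V: "vs1.subspace V" "finite F" "V \<subseteq> vs1.span F"
    and U: "vs2.subspace U" "finite G" "U \<subseteq> vs2.span G"
  shows "vs1.trace_on V (\<lambda>x. g (f x)) = vs2.trace_on U (\<lambda>y. f (g y))"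
proof -
  obtain B where B: "finite B" "B \<subseteq> V" "vs1.independent B" "vs1.span B = V"
    and trB: "\<And>T. vs1.trace_on V T = (\<Sum>b\<in>B. vs1.representation B (T b) b)"
    using vs1.trace_on_basis[OF V] by blast
  obtain C where C: "finite C" "C \<subseteq> U" "vs2.independent C" "vs2.span C = U"
    and trC: "\<And>T. vs2.trace_on U T = (\<Sum>c\<in>C. vs2.representation C (T c) c)"
    using vs2.trace_on_basis[OF U] by blast
  interpret f: Vector_Spaces.linear s1 s2 f by fact
  interpret g: Vector_Spaces.linear s2 s1 g by fact
  have *: "vs1.representation B (g (f b)) b =
      (\<Sum>c\<in>C. vs2.representation C (f b) c * vs1.representation B (g c) b)" if "b \<in> B" for b
  proof -
    have "f b \<in> vs2.span C" using that B C f by blast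
    then have "f b = (\<Sum>c\<in>C. vs2.representation C (f b) c *b c)"
      using vs2.sum_representation_eq[OF C(3) _ C(1) order_refl] by simp
    then have "g (f b) = (\<Sum>c\<in>C. vs2.representation C (f b) c *a g c)"
      by (metis (no_types, lifting) g.scale g.sum sum.cong)
    moreover have "g c \<in> vs1.span B" if "c \<in> C" for c using that B C g by blast
    ultimately show ?thesis
      by (simp add: vs1.representation_sum[OF B(3)] vs1.representation_scale[OF B(3)] vs1.span_scale)
  qed
  have **: "vs2.representation C (f (g c)) c =
      (\<Sum>b\<in>B. vs2.representation C (f b) c * vs1.representation B (g c) b)" if "c \<in> C" for c
  proof -
    have "g c \<in> vs1.span B" using that B C g by blast
    then have "g c = (\<Sum>b\<in>B. vs1.representation B (g c) b *a b)"
      using vs1.sum_representation_eq[OF B(3) _ B(1) order_refl] by simp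
    then have "f (g c) = (\<Sum>b\<in>B. vs1.representation B (g c) b *b f b)"
      by (metis (no_types, lifting) f.scale f.sum sum.cong)
    moreover have "f b \<in> vs2.span C" if "b \<in> B" for b using that B C f by blast
    ultimately show ?thesis
      by (simp add: vs2.representation_sum[OF C(3)] vs2.representation_scale[OF C(3)]
          vs2.span_scale mult.commute)
  qed
  show ?thesis
    by (simp add: trB trC * ** cong: sum.cong) (rule sum.swap)
qed

section \<open>Rotations acting on lattices\<close>

lemma SO_one: "mat 1 \<in> SO"
  by (simp add: SO_def rotation_matrix_def orthogonal_matrix_id)

lemma SO_mult: "g \<in> SO \<Longrightarrow> h \<in> SO \<Longrightarrow> g ** h \<in> SO"
  by (simp add: SO_def rotation_matrix_def orthogonal_matrix_mul det_mul)

lemma SO_transpose: "g \<in> SO \<Longrightarrow> transpose g \<in> SO"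
  by (simp add: SO_def rotation_matrix_def)

lemma SO_transpose_mult:
  assumes "g \<in> SO"
  shows "transpose g ** g = mat 1" "g ** transpose g = mat 1"
  using assms by (auto simp: SO_def rotation_matrix_def orthogonal_matrix_def)

lemma SO_cancel:
  assumes "g \<in> SO"
  shows "transpose g ** (g ** h) = h" "g ** (transpose g ** h) = h"
    "h ** g ** transpose g = h" "h ** transpose g ** g = h"
  using SO_transpose_mult[OF assms]
  by (simp_all add: matrix_mul_assoc) (simp_all add: matrix_mul_assoc[symmetric])

lemma SO_cancel_vec:
  assumes "g \<in> SO"
  shows "transpose g *v (g *v x) = x" "g *v (transpose g *v x) = x"
  by (simp_all only: matrix_vector_mul_assoc SO_transpose_mult[OF assms] matrix_vector_mul_lid)

lemma SO_inner:
  assumes "g \<in> SO"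
  shows "(g *v x) \<bullet> (g *v y) = x \<bullet> y"
  using assms orthogonal_transformation_matrix[of "(*v) g"]
  by (simp add: SO_def rotation_matrix_def orthogonal_transformation_def)

lemma SO_inj: "g \<in> SO \<Longrightarrow> inj_on ((*v) g) S"
  by (rule inj_on_inverseI[where g = "(*v) (transpose g)"]) (rule SO_cancel_vec)

lemma act_one [simp]: "act (mat 1) L = L"
  by (simp add: act_def)

lemma act_act [simp]: "act g (act h L) = act (g ** h) L"
  by (simp add: act_def image_image matrix_vector_mul_assoc)

lemma act_transpose_eq_iff: "g \<in> SO \<Longrightarrow> act (transpose g) M = K \<longleftrightarrow> M = act g K"
  by (auto simp: SO_transpose_mult)

lemma act_Int: "g \<in> SO \<Longrightarrow> act g (K \<inter> L) = act g K \<inter> act g L"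
  unfolding act_def by (rule inj_on_image_Int[OF SO_inj[of g UNIV]]) auto

lemma SO_stab_subset: "SO_stab L \<subseteq> SO"
  by (auto simp: SO_stab_def)

lemma SO_stab_one: "mat 1 \<in> SO_stab L"
  by (simp add: SO_stab_def SO_one)

lemma SO_stab_mult: "g \<in> SO_stab L \<Longrightarrow> h \<in> SO_stab L \<Longrightarrow> g ** h \<in> SO_stab L"
  by (simp add: SO_stab_def SO_mult flip: act_act)

lemma SO_stab_transpose: "g \<in> SO_stab L \<Longrightarrow> transpose g \<in> SO_stab L"
  by (simp add: SO_stab_def SO_transpose act_transpose_eq_iff)

lemma bij_betw_SO_stab_mult:
  assumes "\<delta> \<in> SO_stab L"
  shows "bij_betw (\<lambda>\<gamma>. \<gamma> ** \<delta>) (SO_stab L) (SO_stab L)"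
  using assms SO_stab_subset[of L]
  by (intro bij_betwI[where g = "\<lambda>\<gamma>. \<gamma> ** transpose \<delta>"])
     (auto simp: SO_stab_mult SO_stab_transpose SO_cancel subset_iff)

lemma SO_class_eq_iff: "SO_class K = SO_class L \<longleftrightarrow> (\<exists>g\<in>SO. L = act g K)"
proof
  assume "SO_class K = SO_class L"
  moreover have "act (mat 1) L \<in> SO_class L"
    using SO_one unfolding SO_class_def by blast
  ultimately have "act (mat 1) L \<in> SO_class K"
    by (simp only:)
  then show "\<exists>g\<in>SO. L = act g K"
    by (auto simp: SO_class_def)
next
  assume "\<exists>g\<in>SO. L = act g K"
  then obtain g where g: "g \<in> SO" "L = act g K" by blast
  show "SO_class K = SO_class L"
  proof (intro equalityI subsetI)
    fix M assume "M \<in> SO_class K"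
    then obtain h where "h \<in> SO" "M = act h K" by (auto simp: SO_class_def)
    then have "M = act (h ** transpose g) L" "h ** transpose g \<in> SO"
      using g by (auto simp: SO_mult SO_transpose SO_cancel)
    then show "M \<in> SO_class L" by (auto simp: SO_class_def)
  next
    fix M assume "M \<in> SO_class L"
    then show "M \<in> SO_class K" using g by (auto simp: SO_class_def intro: SO_mult)
  qed
qed

lemma lattice_basis_act:
  assumes "g \<in> SO" "lattice_basis b L"
  shows "lattice_basis (\<lambda>i. g *v b i) (act g L)"
proof -
  have "inj (\<lambda>i. g *v b i)"
    using assms SO_inj[of g UNIV] by (auto simp: lattice_basis_def inj_on_def)
  moreover have "independent (range (\<lambda>i. g *v b i))"
    using linear_independent_injective_image[of "(*v) g" "range b"] assms SO_inj[of g]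
    by (auto simp: lattice_basis_def image_image)
  moreover have "act g L = range (\<lambda>c :: 'a \<Rightarrow> int. \<Sum>i\<in>UNIV. of_int (c i) *\<^sub>R (g *v b i))"
    using assms(2)
    by (simp add: lattice_basis_def act_def image_image linear_sum[OF matrix_vector_mul_linear]
        matrix_vector_mult_scaleR)
  ultimately show ?thesis
    by (simp add: lattice_basis_def)
qed

text \<open>A rotation carries a lattice basis to a lattice basis with the same Gram matrix, so
  integrality, evenness and the determinant are all preserved.\<close>

lemma even_lattices_act:
  assumes g: "g \<in> SO" and L: "L \<in> even_lattices"
  shows "act g L \<in> even_lattices"
proof -
  obtain b where b: "lattice_basis b L"
    using L by (auto simp: even_lattices_def even_lattice_def euclidean_lattice_def)
  note gb = lattice_basis_act[OF g b]
  have "lattice_det (act g L) = lattice_det L"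
    by (simp add: lattice_det_eq[OF b] lattice_det_eq[OF gb] gram_matrix_def SO_inner[OF g])
  then show ?thesis
    using L gb by (auto simp: even_lattices_def even_lattice_def euclidean_lattice_def act_def SO_inner[OF g])
qed

section \<open>Finiteness of the stabiliser of a lattice\<close>

lemma lattice_basis_span:
  fixes b :: "'n::finite \<Rightarrow> real ^ 'n"
  assumes "lattice_basis b L"
  shows "span (range b) = UNIV"
proof -
  have b: "inj b" "independent (range b)"
    using assms by (auto simp: lattice_basis_def)
  then have "card (range b) = DIM(real ^ 'n)"
    by (simp add: card_image)
  then show ?thesis
    using card_ge_dim_independent[of "range b" UNIV] b by auto
qed

text \<open>The difference \<open>x - y\<close> is orthogonal to a spanning set, hence to
  itself.\<close>

lemma inner_eq_on_lattice_basis: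
  assumes "lattice_basis b L" "\<And>j. b j \<bullet> x = b j \<bullet> y"
  shows "x = y"
proof -
  have "(x - y) \<bullet> z = 0" for z
    using lattice_basis_span[OF assms(1)] assms(2)
      orthogonal_to_span[of z "range b" "x - y"]
    by (force simp: orthogonal_def inner_diff inner_commute)
  then show ?thesis
    using inner_eq_zero_iff[of "x - y"] by auto
qed

lemma lattice_basis_mem:
  assumes "lattice_basis b L"
  shows "b i \<in> L"
proof -
  have "b i = (\<Sum>j\<in>UNIV. of_int (if j = i then 1 else 0) *\<^sub>R b j)"
    by (simp add: if_distrib if_distribR sum.delta cong: if_cong)
  then have "b i \<in> range (\<lambda>c :: 'a \<Rightarrow> int. \<Sum>j\<in>UNIV. of_int (c j) *\<^sub>R b j)"
    by (rule range_eqI[where x = "\<lambda>j. if j = i then 1 else 0"])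
  then show ?thesis
    using assms by (simp add: lattice_basis_def)
qed

text \<open>
  An isometry is determined by the numbers \<open>b\<^sub>j \<bullet> g b\<^sub>i\<close>, and for \<open>g\<close> stabilising \<open>L\<close> these are
  integers bounded by Cauchy-Schwarz.
\<close>

lemma finite_SO_stab:
  fixes L :: "(real ^ 'n::finite) set"
  assumes "L \<in> even_lattices"
  shows "finite (SO_stab L)"
proof -
  obtain b where b: "lattice_basis b L"
    using assms by (auto simp: even_lattices_def even_lattice_def euclidean_lattice_def)
  define m where "m = (\<lambda>g (i, j). b j \<bullet> (g *v b i))"
  \<comment> \<open>The sum of all the Cauchy-Schwarz bounds dominates each of them, so a single
    finite set of integers contains every entry \<open>m g p\<close>.\<close>
  define N where "N = (\<Sum>(i, j)\<in>UNIV. norm (b j) * norm (b i))"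
  have "finite ({k::real. k \<in> \<int> \<and> \<bar>k\<bar> \<le> N})"
    by (rule finite_abs_int_segment)
  then have "finite {f :: 'n \<times> 'n \<Rightarrow> real. \<forall>p. p \<in> UNIV \<longrightarrow> f p \<in> {k. k \<in> \<int> \<and> \<bar>k\<bar> \<le> N}}"
    using finite_set_of_finite_funs[of "UNIV :: ('n \<times> 'n) set" "{k::real. k \<in> \<int> \<and> \<bar>k\<bar> \<le> N}"]
    by simp
  moreover have "m g p \<in> {k. k \<in> \<int> \<and> \<bar>k\<bar> \<le> N}" if g: "g \<in> SO_stab L" for g p
  proof -
    obtain i j where p: "p = (i, j)" by force
    have "g *v b i \<in> act g L"
      using lattice_basis_mem[OF b] by (auto simp: act_def)
    then have "g *v b i \<in> L" using g by (simp add: SO_stab_def)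
    then have "m g p \<in> \<int>"
      using assms lattice_basis_mem[OF b]
      by (auto simp: m_def p even_lattices_def even_lattice_def)
    moreover have "norm (g *v b i) = norm (b i)"
      using g SO_inner[of g "b i" "b i"] by (auto simp: norm_eq_sqrt_inner SO_stab_def)
    then have "\<bar>m g p\<bar> \<le> norm (b j) * norm (b i)"
      using Cauchy_Schwarz_ineq2[of "b j" "g *v b i"] by (simp add: m_def p)
    moreover have "norm (b j) * norm (b i) \<le> N"
      unfolding N_def using member_le_sum[of "(i, j)" UNIV "\<lambda>(i, j). norm (b j) * norm (b i)"]
      by auto
    ultimately show ?thesis by simp
  qed
  ultimately have "finite (m ` SO_stab L)"
    by (elim finite_subset[rotated]) auto
  moreover have "inj_on m (SO_stab L)"
  proof (rule inj_onI)
    fix g h assume "m g = m h"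
    then have "b j \<bullet> (g *v b i) = b j \<bullet> (h *v b i)" for i j
      by (simp add: m_def fun_eq_iff)
    then have gh: "g *v b i = h *v b i" for i
      by (rule inner_eq_on_lattice_basis[OF b])
    have "g *v x = h *v x" for x
      using gh lattice_basis_span[OF b]
      by (intro linear_eq_on[of "(*v) g" "(*v) h" x "range b"]) auto
    then show "g = h"
      by (simp add: matrix_eq)
  qed
  ultimately show ?thesis
    by (rule finite_imageD)
qed

section \<open>Neighbours\<close>

lemma group_additive_group_iff:
  fixes L :: "'v::ab_group_add set"
  shows "group (additive_group L) \<longleftrightarrow>
    0 \<in> L \<and> (\<forall>x\<in>L. \<forall>y\<in>L. x + y \<in> L) \<and> (\<forall>x\<in>L. - x \<in> L)"
proof
  assume "group (additive_group L)"
  then interpret group "additive_group L" .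
  have "- x \<in> L" if "x \<in> L" for x
  proof -
    have "\<exists>y\<in>L. y + x = 0"
      using l_inv_ex[of x] that by (simp add: additive_group_def)
    then obtain y where "y \<in> L" "y + x = 0" by blast
    then show ?thesis
      by (metis eq_neg_iff_add_eq_0)
  qed
  then show "0 \<in> L \<and> (\<forall>x\<in>L. \<forall>y\<in>L. x + y \<in> L) \<and> (\<forall>x\<in>L. - x \<in> L)"
    using one_closed m_closed by (auto simp: additive_group_def)
next
  assume "0 \<in> L \<and> (\<forall>x\<in>L. \<forall>y\<in>L. x + y \<in> L) \<and> (\<forall>x\<in>L. - x \<in> L)"
  then show "group (additive_group L)"
    by (intro groupI) (auto simp: additive_group_def add.assoc intro!: bexI[where x = "- x" for x])
qed

lemma normal_additive_group:
  fixes L :: "'v::ab_group_add set"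
  assumes L: "group (additive_group L)" and K: "group (additive_group K)" and "K \<subseteq> L"
  shows "K \<lhd> additive_group L"
proof -
  have "comm_group (additive_group L)"
    using L by (intro group.group_comm_groupI) (auto simp: additive_group_def add.commute)
  moreover have "subgroup K (additive_group L)"
  proof (rule group.subgroupI[OF L])
    fix x assume "x \<in> K"
    then have "inv\<^bsub>additive_group L\<^esub> x = - x"
      using assms by (intro group.inv_equality[OF L])
        (auto simp: group_additive_group_iff, auto simp: additive_group_def)
    then show "inv\<^bsub>additive_group L\<^esub> x \<in> K"
      using K \<open>x \<in> K\<close> by (simp add: group_additive_group_iff)
  qed (use assms in \<open>auto simp: group_additive_group_iff\<close>, auto simp: additive_group_def)
  ultimately show ?thesis
    by (rule comm_group.subgroup_imp_normal)
qed

lemma r_coset_additive_group: "K #>\<^bsub>additive_group L\<^esub> x = (\<lambda>k. k + x) ` K"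
  by (auto simp: r_coset_def additive_group_def)

lemma r_coset_additive_group_eq_iff:
  fixes K :: "'v::ab_group_add set"
  assumes "group (additive_group K)"
  shows "K #>\<^bsub>additive_group L\<^esub> x = K \<longleftrightarrow> x \<in> K"
proof
  assume "K #>\<^bsub>additive_group L\<^esub> x = K"
  moreover have "0 + x \<in> K #>\<^bsub>additive_group L\<^esub> x"
    using assms unfolding r_coset_additive_group group_additive_group_iff by blast
  ultimately show "x \<in> K" by simp
next
  assume x: "x \<in> K"
  have "k \<in> (\<lambda>k. k + x) ` K" if "k \<in> K" for k
  proof (rule image_eqI)
    show "k + (- x) \<in> K"
      using assms that x unfolding group_additive_group_iff by blast
  qed simp
  then show "K #>\<^bsub>additive_group L\<^esub> x = K"
    using assms x by (auto simp: r_coset_additive_group group_additive_group_iff)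
qed

lemma additive_group_Mod_image:
  fixes L K :: "'v::ab_group_add set" and f :: "'v \<Rightarrow> 'u::ab_group_add"
  assumes L: "group (additive_group L)" and K: "group (additive_group K)" and "K \<subseteq> L"
    and f: "Modules.additive f" "inj_on f L"
  shows "additive_group L Mod K \<cong> additive_group (f ` L) Mod (f ` K)"
proof -
  interpret f: Modules.additive f by fact
  have im: "group (additive_group (f ` M))" if "group (additive_group M)" for M
    using that unfolding group_additive_group_iff
    by (auto simp flip: f.add f.minus f.zero)
  interpret N: normal "f ` K" "additive_group (f ` L)"
    using L K \<open>K \<subseteq> L\<close> by (intro normal_additive_group im) auto
  let ?h = "(\<lambda>x. f ` K #>\<^bsub>additive_group (f ` L)\<^esub> x) \<circ> f"
  have "f \<in> hom (additive_group L) (additive_group (f ` L))"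
    by (auto simp: hom_def additive_group_def f.add)
  then have "?h \<in> hom (additive_group L) (additive_group (f ` L) Mod f ` K)"
    using N.r_coset_hom_Mod by (rule hom_compose)
  then interpret h: group_hom "additive_group L" "additive_group (f ` L) Mod f ` K" ?h
    using L N.factorgroup_is_group by (simp add: group_hom_def group_hom_axioms_def)
  have "f x \<in> f ` K \<longleftrightarrow> x \<in> K" if "x \<in> L" for x
    using inj_on_image_mem_iff[OF f(2) that \<open>K \<subseteq> L\<close>] .
  then have "kernel (additive_group L) (additive_group (f ` L) Mod f ` K) ?h = K"
    using \<open>K \<subseteq> L\<close>
    by (auto simp: kernel_def FactGroup_def r_coset_additive_group_eq_iff[OF im[OF K]])
      (auto simp: additive_group_def)
  moreover have "?h ` carrier (additive_group L) = carrier (additive_group (f ` L) Mod f ` K)"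
    by (auto simp: FactGroup_def RCOSETS_def additive_group_def)
  ultimately show ?thesis
    using h.FactGroup_iso by simp
qed

text \<open>By Lagrange, the order of the quotient, which is that of \<open>A\<close>, kills the
  coset of \<open>x\<close>. Powers in \<open>additive_group L\<close> are integer multiples,
  written here as real scalings.\<close>

lemma additive_group_Mod_exponent:
  fixes L K :: "'v::real_vector set"
  assumes L: "group (additive_group L)" and K: "group (additive_group K)" and "K \<subseteq> L"
    and A: "additive_group L Mod K \<cong> A"
    and "x \<in> L"
  shows "real (card (carrier A)) *\<^sub>R x \<in> K"
proof -
  let ?G = "additive_group L"
  interpret N: normal K ?G
    by (rule normal_additive_group) fact+
  interpret h: group_hom ?G "?G Mod K" "\<lambda>x. K #>\<^bsub>?G\<^esub> x"
    using L N.factorgroup_is_group N.r_coset_hom_Mod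
    by (simp add: group_hom_def group_hom_axioms_def)
  have x: "x \<in> carrier ?G"
    using \<open>x \<in> L\<close> by (simp add: additive_group_def)
  have pow: "x [^]\<^bsub>?G\<^esub> n = real n *\<^sub>R x" for n :: nat
    by (induction n) (auto simp: N.nat_pow_Suc algebra_simps, auto simp: additive_group_def)
  have "K #>\<^bsub>?G\<^esub> (real (order (?G Mod K)) *\<^sub>R x) = (K #>\<^bsub>?G\<^esub> x) [^]\<^bsub>?G Mod K\<^esub> order (?G Mod K)"
    using h.hom_nat_pow[OF x] by (simp add: pow)
  also have "\<dots> = K"
    using h.H.pow_order_eq_1[OF h.hom_closed[OF x]] by (simp add: FactGroup_def)
  finally show ?thesis
    using iso_same_card[OF A] by (simp add: r_coset_additive_group_eq_iff[OF K] order_def)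
qed

section \<open>Finiteness of the set of neighbours\<close>

lemma group_even_lattice:
  assumes "L \<in> even_lattices"
  shows "group (additive_group L)"
proof -
  obtain b where b: "lattice_basis b L"
    using assms by (auto simp: even_lattices_def even_lattice_def euclidean_lattice_def)
  define \<phi> where "\<phi> = (\<lambda>c :: 'a \<Rightarrow> int. \<Sum>i\<in>UNIV. of_int (c i) *\<^sub>R b i)"
  have L: "L = range \<phi>"
    using b by (simp add: lattice_basis_def \<phi>_def)
  have "\<phi> c + \<phi> d = \<phi> (\<lambda>i. c i + d i)" "- \<phi> c = \<phi> (\<lambda>i. - c i)" for c d
    by (simp_all add: \<phi>_def sum.distrib sum_negf scaleR_add_left)
  moreover have "0 = \<phi> (\<lambda>_. 0)"
    by (simp add: \<phi>_def)
  ultimately show ?thesis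
    unfolding group_additive_group_iff L by blast
qed

lemma group_additive_group_Int:
  "group (additive_group K) \<Longrightarrow> group (additive_group L) \<Longrightarrow> group (additive_group (K \<inter> L))"
  by (auto simp: group_additive_group_iff)

text \<open>A subgroup between \<open>N L\<close> and \<open>L\<close> is determined by the residues modulo \<open>N L\<close> it contains.\<close>

lemma finite_subgroups_between:
  fixes L :: "(real ^ 'n::finite) set"
  assumes b: "lattice_basis b L" and N: "0 < (N::int)"
  shows "finite {K. group (additive_group K) \<and> (\<lambda>x. of_int N *\<^sub>R x) ` L \<subseteq> K \<and> K \<subseteq> L}"
    (is "finite ?S")
proof -
  define \<phi> where "\<phi> = (\<lambda>c :: 'n \<Rightarrow> int. \<Sum>i\<in>UNIV. of_int (c i) *\<^sub>R b i)"
  have L: "L = range \<phi>"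
    using b by (simp add: lattice_basis_def \<phi>_def)
  \<comment> \<open>Vectors with coordinates from 0 to \<open>N - 1\<close> represent all residues
    modulo \<open>N L\<close>.\<close>
  define F where "F = \<phi> ` {c. \<forall>i. i \<in> UNIV \<longrightarrow> c i \<in> {0..<N}}"
  have "finite {c :: 'n \<Rightarrow> int. \<forall>i. i \<in> UNIV \<longrightarrow> c i \<in> {0..<N}}"
    using finite_set_of_finite_funs[of "UNIV :: 'n set" "{0..<N}"] by simp
  then have "finite F"
    by (simp add: F_def)
  have reduce: "\<exists>y\<in>F. x - y \<in> K \<and> y - x \<in> K" if "x \<in> L" "K \<in> ?S" for x K
  proof -
    obtain c where c: "x = \<phi> c"
      using \<open>x \<in> L\<close> L by blast
    have "\<phi> c - \<phi> (\<lambda>i. c i mod N) = of_int N *\<^sub>R \<phi> (\<lambda>i. c i div N)"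
      unfolding \<phi>_def scaleR_sum_right sum_subtractf[symmetric]
      by (intro sum.cong refl)
        (simp add: scaleR_diff_left[symmetric] of_int_diff[symmetric] of_int_mult[symmetric]
           minus_mod_eq_mult_div del: of_int_diff of_int_mult)
    then have "x - \<phi> (\<lambda>i. c i mod N) \<in> K"
      using \<open>K \<in> ?S\<close> c L by auto
    moreover from this have "- (x - \<phi> (\<lambda>i. c i mod N)) \<in> K"
      using \<open>K \<in> ?S\<close> unfolding group_additive_group_iff by blast
    moreover have "\<phi> (\<lambda>i. c i mod N) \<in> F"
      using N by (auto simp: F_def)
    ultimately show ?thesis
      by (intro bexI[where x = "\<phi> (\<lambda>i. c i mod N)"]) auto
  qed
  have sub: "K1 \<subseteq> K2" if "K1 \<in> ?S" "K2 \<in> ?S" "K1 \<inter> F = K2 \<inter> F" for K1 K2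
  proof
    fix x assume x: "x \<in> K1"
    then have "x \<in> L" using \<open>K1 \<in> ?S\<close> by blast
    \<comment> \<open>The intersection again lies between \<open>N L\<close> and \<open>L\<close>.
      Reducing modulo it yields one residue \<open>y\<close> congruent to \<open>x\<close> modulo
      both subgroups, so membership passes from \<open>K1\<close> to \<open>K2\<close> through
      \<open>F\<close>.\<close>
    have "K1 \<inter> K2 \<in> ?S"
      using \<open>K1 \<in> ?S\<close> \<open>K2 \<in> ?S\<close> group_additive_group_Int[of K1 K2] by blast
    from reduce[OF \<open>x \<in> L\<close> this]
    obtain y where y: "y \<in> F" "x - y \<in> K2" "y - x \<in> K1"
      by blast
    have "(y - x) + x \<in> K1"
      using y x \<open>K1 \<in> ?S\<close> unfolding group_additive_group_iff by blast
    then have "y \<in> K2" using y that by auto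
    then have "(x - y) + y \<in> K2"
      using y \<open>K2 \<in> ?S\<close> unfolding group_additive_group_iff by blast
    then show "x \<in> K2" by simp
  qed
  have "inj_on (\<lambda>K. K \<inter> F) ?S"
  proof (rule inj_onI)
    fix K1 K2 assume K: "K1 \<in> ?S" "K2 \<in> ?S" "K1 \<inter> F = K2 \<inter> F"
    show "K1 = K2"
      using sub[OF K] sub[OF K(2,1) K(3)[symmetric]] by (rule equalityI)
  qed
  moreover have "(\<lambda>K. K \<inter> F) ` ?S \<subseteq> Pow F"
    by blast
  then have "finite ((\<lambda>K. K \<inter> F) ` ?S)"
    by (rule finite_subset) (simp add: \<open>finite F\<close>)
  ultimately show ?thesis
    by (rule finite_imageD[rotated])
qed

text \<open>With \<open>m = |A|\<close>, every \<open>A\<close>-neighbour \<open>M\<close> of \<open>L\<close> satisfies \<open>m\<^sup>2 L \<subseteq> m M \<subseteq> L\<close>.\<close>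

lemma finite_neighbours:
  fixes L :: "(real ^ 'n::finite) set"
  assumes L: "L \<in> even_lattices" and A: "group A" "finite (carrier A)"
  shows "finite (neighbours A L)"
proof -
  define m where "m = card (carrier A)"
  have m: "m > 0"
    using A group.is_monoid[OF A(1)] monoid.one_closed by (auto simp: m_def card_gt_0_iff)
  let ?scale = "\<lambda>M :: (real ^ 'n) set. (\<lambda>x. real m *\<^sub>R x) ` M"
  obtain b where b: "lattice_basis b L"
    using L by (auto simp: even_lattices_def even_lattice_def euclidean_lattice_def)
  have sub: "?scale L \<subseteq> M \<and> ?scale M \<subseteq> L \<and> group (additive_group M)"
    if "M \<in> neighbours A L" for M
  proof -
    have M: "M \<in> even_lattices" "additive_group L Mod (L \<inter> M) \<cong> A"
      "additive_group M Mod (L \<inter> M) \<cong> A"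
      using that by (auto simp: neighbours_def)
    note gr = group_even_lattice[OF L] group_even_lattice[OF M(1)]
    note gr' = group_additive_group_Int[OF gr]
    have "real m *\<^sub>R x \<in> L \<inter> M" if "x \<in> L" for x
      unfolding m_def by (rule additive_group_Mod_exponent[OF gr(1) gr' _ M(2) that]) simp
    moreover have "real m *\<^sub>R x \<in> L \<inter> M" if "x \<in> M" for x
      unfolding m_def by (rule additive_group_Mod_exponent[OF gr(2) gr' _ M(3) that]) simp
    ultimately show ?thesis
      using gr by auto
  qed
  have "?scale ` neighbours A L \<subseteq>
    {K. group (additive_group K) \<and> (\<lambda>x. of_int (int (m * m)) *\<^sub>R x) ` L \<subseteq> K \<and> K \<subseteq> L}"
  proof (clarify, intro conjI)
    fix M assume M: "M \<in> neighbours A L"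
    then have "group (additive_group M)"
      using sub by blast
    then show "group (additive_group (?scale M))"
      unfolding group_additive_group_iff ball_simps(9)
      by (metis (no_types, lifting) imageI scaleR_add_right scaleR_minus_right scaleR_zero_right)
    show "?scale M \<subseteq> L" using sub[OF M] by blast
    have "(\<lambda>x. of_int (int (m * m)) *\<^sub>R x) ` L = ?scale (?scale L)"
      by (simp add: image_image)
    also have "\<dots> \<subseteq> ?scale M"
      using sub[OF M] by (intro image_mono) blast
    finally show "(\<lambda>x. of_int (int (m * m)) *\<^sub>R x) ` L \<subseteq> ?scale M" .
  qed
  then have "finite (?scale ` neighbours A L)"
    by (rule finite_subset) (rule finite_subgroups_between[OF b], use m in simp)
  \<comment> \<open>Since \<open>m\<close> is positive, a neighbour is recovered from its rescaling,
    and finiteness of the rescaled family transfers back.\<close>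
  moreover have "inj (\<lambda>x :: real ^ 'n. real m *\<^sub>R x)"
    using m by (auto simp: inj_on_def)
  then have "inj ?scale"
    by (intro injI) (simp add: inj_image_eq_iff)
  ultimately show ?thesis
    using finite_imageD inj_on_subset by blast
qed

section \<open>Rotations permute the neighbour relation\<close>

lemma act_neighbours:
  assumes g: "g \<in> SO" and L: "L \<in> even_lattices" and M: "M \<in> neighbours A L"
  shows "act g M \<in> neighbours A (act g L)"
proof -
  have M: "M \<in> even_lattices" "additive_group L Mod (L \<inter> M) \<cong> A"
    "additive_group M Mod (L \<inter> M) \<cong> A"
    using M by (auto simp: neighbours_def)
  have iso: "additive_group (act g X) Mod (act g L \<inter> act g M) \<cong> additive_group X Mod (L \<inter> M)"
    if "X = L \<or> X = M" for X
  proof -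
    \<comment> \<open>Using the inverse rotation gives an isomorphism from the rotated quotient to
      the original one, which composes directly with the given isomorphism to
      \<open>A\<close>.\<close>
    have "Modules.additive ((*v) (transpose g))"
      by (simp add: Modules.additive_def matrix_vector_right_distrib)
    moreover have "inj_on ((*v) (transpose g)) (act g X)"
      by (rule SO_inj[OF SO_transpose[OF g]])
    moreover have "group (additive_group (act g L))" "group (additive_group (act g M))"
      using g L M even_lattices_act group_even_lattice by blast+
    ultimately have "additive_group (act g X) Mod (act g (L \<inter> M)) \<cong>
        additive_group (act (transpose g) (act g X)) Mod (act (transpose g) (act g (L \<inter> M)))"
      using that act_Int[OF g, of L M] unfolding act_def[of "transpose g"]
      by (intro additive_group_Mod_image) (auto intro: group_additive_group_Int)
    then show ?thesis
      by (simp add: act_Int[OF g, of L M] SO_transpose_mult[OF g])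
        (simp add: act_Int[OF g, of L M, symmetric] SO_transpose_mult[OF g])
  qed
  show ?thesis
    using M even_lattices_act[OF g M(1)] iso[of L] iso[of M]
    by (auto simp: neighbours_def intro: iso_trans)
qed

text \<open>One inclusion is \<open>act_neighbours\<close> for \<open>g\<close>, the other is the
  same lemma for its inverse \<open>transpose g\<close>.\<close>

lemma neighbours_act:
  assumes g: "g \<in> SO" and L: "L \<in> even_lattices"
  shows "neighbours A (act g L) = act g ` neighbours A L"
proof (intro equalityI subsetI)
  fix M assume "M \<in> neighbours A (act g L)"
  then have "act (transpose g) M \<in> neighbours A (act (transpose g) (act g L))"
    by (rule act_neighbours[OF SO_transpose[OF g] even_lattices_act[OF g L]])
  then have "act (transpose g) M \<in> neighbours A L"
    by (simp add: SO_transpose_mult[OF g])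
  moreover have "M = act g (act (transpose g) M)"
    by (simp add: SO_transpose_mult[OF g])
  ultimately show "M \<in> act g ` neighbours A L"
    by blast
qed (use act_neighbours[OF g L] in blast)

lemma isometric_neighbours_act:
  assumes "L \<in> even_lattices" "\<gamma> \<in> SO_stab L" "M \<in> isometric_neighbours A L"
  shows "act \<gamma> M \<in> isometric_neighbours A L"
  using assms act_neighbours[of \<gamma> L M A]
  by (auto simp: isometric_neighbours_def SO_stab_def intro: SO_mult)

section \<open>The trace of the Hecke operator\<close>

lemma sum_fun_apply: "(\<Sum>i\<in>I. f i) x = (\<Sum>i\<in>I. f i x)"
  by (induction I rule: infinite_finite_induct) auto

text \<open>When nonempty, this is a left coset of \<open>SO_stab K\<close>. Summing over all of it
  avoids choosing one rotation from \<open>K\<close> to \<open>M\<close>.\<close>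

definition transporter :: "(real ^ 'n::finite) set \<Rightarrow> (real ^ 'n) set \<Rightarrow> (real ^ 'n ^ 'n) set" where
  "transporter K M = {g \<in> SO. act g K = M}"

lemma transporter_act:
  assumes "g \<in> SO"
  shows "transporter K (act g M) = (\<lambda>h. g ** h) ` transporter K M"
proof (intro equalityI subsetI)
  fix h assume h: "h \<in> transporter K (act g M)"
  then have "transpose g ** h \<in> transporter K M"
    using assms by (simp add: transporter_def SO_mult SO_transpose SO_transpose_mult flip: act_act)
      (simp add: SO_transpose_mult)
  moreover have "h = g ** (transpose g ** h)"
    by (simp add: SO_cancel[OF assms])
  ultimately show "h \<in> (\<lambda>h. g ** h) ` transporter K M"
    by blast
qed (use assms in \<open>auto simp: transporter_def SO_mult simp flip: act_act\<close>)

text \<open>Left translation by \<open>g\<close> matches the two transporters. This yields the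
  equivariance of \<open>orbit_form\<close> and, for \<open>M = K\<close>, its expression as a sum
  over the stabiliser.\<close>

lemma sum_transporter_act:
  assumes "g \<in> SO"
  shows "(\<Sum>h\<in>transporter K (act g M). F h) = (\<Sum>h\<in>transporter K M. F (g ** h))"
proof -
  have "inj_on (\<lambda>h. g ** h) (transporter K M)"
    by (rule inj_on_inverseI[where g = "\<lambda>h. transpose g ** h"]) (rule SO_cancel[OF assms])
  then show ?thesis
    by (simp add: transporter_act[OF assms] sum.reindex)
qed

lemma transporter_self: "transporter K K = SO_stab K"
  by (simp add: transporter_def SO_stab_def)

lemma transporter_empty: "K \<in> even_lattices \<Longrightarrow> M \<notin> even_lattices \<Longrightarrow> transporter K M = {}"
  by (auto simp: transporter_def even_lattices_act)

text \<open>
  The average over all \<open>g\<close> carrying \<open>K\<close> to \<open>M\<close> projects \<open>w\<close> to the invariants of the stabiliser of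
  \<open>K\<close> and extends the result equivariantly to the class of \<open>K\<close>; off that class it is \<open>0\<close>.
\<close>

definition orbit_form ::
  "(complex \<Rightarrow> 'w::ab_group_add \<Rightarrow> 'w) \<Rightarrow> (real ^ 'n::finite ^ 'n \<Rightarrow> 'w \<Rightarrow> 'w) \<Rightarrow>
   (real ^ 'n) set \<Rightarrow> 'w \<Rightarrow> (real ^ 'n) set \<Rightarrow> 'w" where
  "orbit_form sc \<rho> K w M = sc (1 / of_nat (card (SO_stab K))) (\<Sum>g\<in>transporter K M. \<rho> g w)"

section \<open>Automorphic forms, class projections and the Hecke operator\<close>

locale SO_rep = finite_dimensional_vector_space sc basis_W
  for sc :: "complex \<Rightarrow> 'w::ab_group_add \<Rightarrow> 'w" and basis_W :: "'w set" +
  fixes \<rho> :: "real ^ 'n::finite ^ 'n \<Rightarrow> 'w \<Rightarrow> 'w"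
  assumes rep: "SO_representation sc \<rho>"
begin

sublocale forms: vector_space "fun_scale sc :: complex \<Rightarrow> ((real ^ 'n) set \<Rightarrow> 'w) \<Rightarrow> _"
  by (rule vector_space_fun_scale) (rule vector_space_axioms)

abbreviation "M\<^sub>W \<equiv> automorphic_forms \<rho>"

lemma rho_linear: "g \<in> SO \<Longrightarrow> Vector_Spaces.linear sc sc (\<rho> g)"
  using rep by (simp add: SO_representation_def)

lemma rho_mult: "g \<in> SO \<Longrightarrow> h \<in> SO \<Longrightarrow> \<rho> (g ** h) w = \<rho> g (\<rho> h w)"
  using rep by (simp add: SO_representation_def)

lemma rho_add: "g \<in> SO \<Longrightarrow> \<rho> g (v + w) = \<rho> g v + \<rho> g w"
  by (rule module_hom.add[OF rho_linear[folded module_hom_iff_linear]])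

lemma rho_scale: "g \<in> SO \<Longrightarrow> \<rho> g (sc c w) = sc c (\<rho> g w)"
  by (rule module_hom.scale[OF rho_linear[folded module_hom_iff_linear]])

lemma rho_sum: "g \<in> SO \<Longrightarrow> \<rho> g (\<Sum>i\<in>I. f i) = (\<Sum>i\<in>I. \<rho> g (f i))"
  by (rule module_hom.sum[OF rho_linear[folded module_hom_iff_linear]])

lemma rho_zero: "g \<in> SO \<Longrightarrow> \<rho> g 0 = 0"
  by (rule module_hom.zero[OF rho_linear[folded module_hom_iff_linear]])

lemma subspace_forms: "forms.subspace M\<^sub>W"
  by (rule forms.subspaceI)
    (auto simp: automorphic_forms_def rho_zero rho_add rho_scale fun_scale_def)

lemma linear_orbit_form: "Vector_Spaces.linear sc (fun_scale sc) (orbit_form sc \<rho> K)"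
proof -
  have "\<rho> g (v + w) = \<rho> g v + \<rho> g w" "\<rho> g (sc c w) = sc c (\<rho> g w)"
    if "g \<in> transporter K M" for g c v w M
    using that by (auto simp: transporter_def rho_add rho_scale)
  then show ?thesis
    by (auto intro!: Vector_Spaces.linear.intro module_hom.intro module_hom_axioms.intro
        vector_space_axioms forms.vector_space_axioms module_axioms forms.module_axioms
        simp: fun_eq_iff orbit_form_def fun_scale_def sum.distrib scale_right_distrib
          scale_sum_right scale_left_commute mult.commute)
qed

text \<open>Replacing \<open>M\<close> by \<open>act g M\<close> multiplies every transporting
  rotation by \<open>g\<close> on the left, and \<open>\<rho> g\<close> then comes out of the sum.
  Outside \<open>even_lattices\<close> the transporter is empty, in agreement with extension by
  zero.\<close>

lemma orbit_form_in_forms: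
  assumes "K \<in> even_lattices"
  shows "orbit_form sc \<rho> K w \<in> M\<^sub>W"
proof -
  have "orbit_form sc \<rho> K w (act g M) = \<rho> g (orbit_form sc \<rho> K w M)" if "g \<in> SO" for g M
  proof -
    have "(\<Sum>h\<in>transporter K M. \<rho> (g ** h) w) = (\<Sum>h\<in>transporter K M. \<rho> g (\<rho> h w))"
      using that by (intro sum.cong refl rho_mult) (auto simp: transporter_def)
    then show ?thesis
      using that by (simp add: orbit_form_def sum_transporter_act rho_scale rho_sum)
  qed
  moreover have "orbit_form sc \<rho> K w M = 0" if "M \<notin> even_lattices" for M
    using that assms by (simp add: orbit_form_def transporter_empty)
  ultimately show ?thesis
    by (simp add: automorphic_forms_def)
qed

text \<open>Equivariance of \<open>f\<close> makes every term of the average over the transporter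
  equal to \<open>f M\<close>, and there are as many terms as elements of
  \<open>SO_stab K\<close>.\<close>

lemma orbit_form_on_class:
  assumes f: "f \<in> M\<^sub>W" and K: "K \<in> even_lattices" and M: "M \<in> SO_class K"
  shows "orbit_form sc \<rho> K (f K) M = f M"
proof -
  obtain g where g: "g \<in> SO" "M = act g K"
    using M by (auto simp: SO_class_def)
  have "\<rho> (g ** \<gamma>) (f K) = f M" if "\<gamma> \<in> SO_stab K" for \<gamma>
  proof -
    have "\<rho> (g ** \<gamma>) (f K) = f (act (g ** \<gamma>) K)"
      using f K g that by (simp add: automorphic_forms_def SO_stab_def SO_mult)
    also have "act (g ** \<gamma>) K = M"
      using g that by (simp add: SO_stab_def flip: act_act)
    finally show ?thesis .
  qed
  then have "orbit_form sc \<rho> K (f K) M = sc (1 / of_nat (card (SO_stab K))) (\<Sum>\<gamma>\<in>SO_stab K. f M)"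
    by (simp add: orbit_form_def g sum_transporter_act transporter_self)
  also have "(\<Sum>\<gamma>\<in>SO_stab K. f M) = sc (of_nat (card (SO_stab K))) (f M)"
    by (simp add: sum_constant_scale)
  finally show ?thesis
    \<comment> \<open>The stabiliser is finite and contains the identity, so its cardinality is
      nonzero and cancels.\<close>
    using finite_SO_stab[OF K] SO_stab_one[of K] by auto
qed

lemma orbit_form_off_class: "M \<notin> SO_class K \<Longrightarrow> orbit_form sc \<rho> K w M = 0"
  by (auto simp: orbit_form_def transporter_def SO_class_def intro!: sum.neutral)

lemma linear_hecke:
  "Vector_Spaces.linear (fun_scale sc) (fun_scale sc) (hecke A :: ((real ^ 'n) set \<Rightarrow> 'w) \<Rightarrow> _)"
  by (auto intro!: Vector_Spaces.linear.intro module_hom.intro module_hom_axioms.intro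
        forms.vector_space_axioms forms.module_axioms
        simp: fun_eq_iff hecke_def fun_scale_def sum.distrib scale_sum_right)

text \<open>The neighbours of \<open>act g K\<close> are the \<open>g\<close>-translates of those of
  \<open>K\<close>, so reindexing the sum pulls out \<open>\<rho> g\<close>.\<close>

lemma hecke_in_forms:
  assumes f: "f \<in> M\<^sub>W"
  shows "hecke A f \<in> M\<^sub>W"
proof -
  have "hecke A f (act g K) = \<rho> g (hecke A f K)" if g: "g \<in> SO" and K: "K \<in> even_lattices" for g K
  proof -
    have "inj_on (act g) (neighbours A K)"
      by (rule inj_on_inverseI[where g = "act (transpose g)"]) (simp add: SO_transpose_mult[OF g])
    then have "hecke A f (act g K) = (\<Sum>M\<in>neighbours A K. f (act g M))"
      using K even_lattices_act[OF g K] by (simp add: hecke_def neighbours_act[OF g K] sum.reindex)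
    also have "\<dots> = (\<Sum>M\<in>neighbours A K. \<rho> g (f M))"
      using f g by (intro sum.cong) (auto simp: neighbours_def automorphic_forms_def)
    finally show ?thesis
      using g K by (simp add: hecke_def rho_sum)
  qed
  then show ?thesis
    by (simp add: automorphic_forms_def hecke_def)
qed

lemma linear_eval: "Vector_Spaces.linear (fun_scale sc) sc (\<lambda>f :: (real ^ 'n) set \<Rightarrow> 'w. f K)"
  by (auto intro!: Vector_Spaces.linear.intro module_hom.intro module_hom_axioms.intro
        vector_space_axioms forms.vector_space_axioms module_axioms forms.module_axioms
        simp: fun_scale_def)

section \<open>Computation of the trace\<close>

lemma UNIV_spanned: "subspace UNIV" "finite basis_W" "UNIV \<subseteq> span basis_W"
  by (simp_all add: finite_Basis span_Basis)

lemma trace_rho_commute: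
  assumes "g \<in> SO" "h \<in> SO"
  shows "trace_on UNIV (\<rho> (g ** h)) = trace_on UNIV (\<rho> (h ** g))"
proof -
  interpret vector_space_pair sc sc
    by (intro vector_space_pair.intro vector_space_axioms)
  have "trace_on UNIV (\<lambda>w. \<rho> g (\<rho> h w)) = trace_on UNIV (\<lambda>w. \<rho> h (\<rho> g w))"
    by (rule trace_on_cyclic[OF rho_linear _ rho_linear _ UNIV_spanned UNIV_spanned])
      (use assms in auto)
  moreover have "\<rho> (g ** h) = (\<lambda>w. \<rho> g (\<rho> h w))" "\<rho> (h ** g) = (\<lambda>w. \<rho> h (\<rho> g w))"
    using assms by (auto simp: rho_mult)
  ultimately show ?thesis by simp
qed

text \<open>For \<open>M = act (\<delta> ** g) K\<close> the transporter consists of the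
  \<open>\<delta> ** g ** \<gamma>\<close> with \<open>\<gamma>\<close> in the stabiliser. Cyclicity
  turns each into \<open>\<gamma> ** \<delta> ** g\<close>, and right multiplication by
  \<open>\<delta>\<close> permutes the stabiliser. Hence the trace is constant on the orbit.\<close>

lemma trace_orbit_form:
  assumes g: "g \<in> SO" and M: "M \<in> SO_stab_orbit K (act g K)"
  shows "trace_on UNIV (\<lambda>w. orbit_form sc \<rho> K w M) =
    1 / of_nat (card (SO_stab K)) * (\<Sum>\<gamma>\<in>SO_stab K. trace_on UNIV (\<rho> (\<gamma> ** g)))"
proof -
  obtain \<delta> where \<delta>: "\<delta> \<in> SO_stab K" "M = act (\<delta> ** g) K"
    using M by (auto simp: SO_stab_orbit_def)
  have SO: "\<delta> \<in> SO" "\<delta> ** g \<in> SO"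
    using \<delta> g SO_stab_subset SO_mult by blast+
  let ?c = "1 / of_nat (card (SO_stab K)) :: complex"
  have "orbit_form sc \<rho> K w M = (\<Sum>\<gamma>\<in>SO_stab K. sc ?c (\<rho> (\<delta> ** g ** \<gamma>) w))" for w
    using SO by (simp add: orbit_form_def \<delta>(2) sum_transporter_act transporter_self scale_sum_right
        del: act_act)
  then have "trace_on UNIV (\<lambda>w. orbit_form sc \<rho> K w M) =
      (\<Sum>\<gamma>\<in>SO_stab K. ?c * trace_on UNIV (\<rho> (\<delta> ** g ** \<gamma>)))"
    by (intro trace_on_sum_scale[OF UNIV_spanned]) auto
  also have "\<dots> = ?c * (\<Sum>\<gamma>\<in>SO_stab K. trace_on UNIV (\<rho> ((\<gamma> ** \<delta>) ** g)))"
    unfolding sum_distrib_left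
    using SO SO_stab_subset[of K] trace_rho_commute[OF SO(2)]
    by (intro sum.cong refl) (auto simp: matrix_mul_assoc)
  also have "(\<Sum>\<gamma>\<in>SO_stab K. trace_on UNIV (\<rho> ((\<gamma> ** \<delta>) ** g))) =
      (\<Sum>\<gamma>\<in>SO_stab K. trace_on UNIV (\<rho> (\<gamma> ** g)))"
    by (rule sum.reindex_bij_betw[OF bij_betw_SO_stab_mult[OF \<delta>(1)],
        of "\<lambda>\<gamma>. trace_on UNIV (\<rho> (\<gamma> ** g))"])
  finally show ?thesis .
qed

lemma trace_hecke:
  fixes h :: nat
  assumes L: "\<forall>i\<in>{1..h}. L i \<in> even_lattices"
    and reps: "bij_betw (\<lambda>i. SO_class (L i)) {1..h} lattice_classes"
  shows "forms.trace_on M\<^sub>W (hecke A) =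
    (\<Sum>i=1..h. trace_on UNIV (\<lambda>w. hecke A (orbit_form sc \<rho> (L i) w) (L i)))"
proof -
  have split: "f = (\<Sum>i=1..h. orbit_form sc \<rho> (L i) (f (L i)))" if f: "f \<in> M\<^sub>W" for f
  proof
    fix M
    show "f M = (\<Sum>i=1..h. orbit_form sc \<rho> (L i) (f (L i))) M"
    proof (cases "M \<in> even_lattices")
      case True
      then obtain i where i: "i \<in> {1..h}" "SO_class M = SO_class (L i)"
        using reps unfolding bij_betw_def lattice_classes_def by (metis (mono_tags) imageE imageI)
      \<comment> \<open>Distinct indices represent distinct classes, so only the summand of the
        class of \<open>M\<close> survives at \<open>M\<close>.\<close>
      have mem: "M \<in> SO_class (L k) \<longleftrightarrow> k = i" if "k \<in> {1..h}" for k
      proof -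
        have "M \<in> SO_class (L k) \<longleftrightarrow> SO_class (L k) = SO_class M"
          unfolding SO_class_eq_iff by (auto simp: SO_class_def)
        then show ?thesis
          using inj_on_eq_iff[OF bij_betw_imp_inj_on[OF reps] that i(1)] i(2) by simp
      qed
      have "(\<Sum>k=1..h. orbit_form sc \<rho> (L k) (f (L k))) M = (\<Sum>k=1..h. if k = i then f M else 0)"
        unfolding sum_fun_apply using mem f L
        by (intro sum.cong refl) (auto simp: orbit_form_on_class orbit_form_off_class)
      then show ?thesis
        using i by (simp add: sum.delta)
    next
      case False
      have "(\<Sum>i=1..h. orbit_form sc \<rho> (L i) (f (L i))) M = 0"
        unfolding sum_fun_apply using False L
        by (intro sum.neutral) (auto simp: orbit_form_def transporter_empty)
      then show ?thesis
        using f False by (simp add: automorphic_forms_def)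
    qed
  qed
  interpret T: Vector_Spaces.linear "fun_scale sc" "fun_scale sc"
    "hecke A :: ((real ^ 'n) set \<Rightarrow> 'w) \<Rightarrow> _"
    by (rule linear_hecke)
  \<comment> \<open>By \<open>split\<close>, every form is a sum of orbit forms, so the orbit forms
    of basis vectors of \<open>W\<close> are a finite spanning set. This is the
    finite-dimensionality of \<open>M\<^sub>W\<close> that the trace lemmas require.\<close>
  let ?F = "\<Union>i\<in>{1..h}. orbit_form sc \<rho> (L i) ` basis_W"
  have fin: "finite ?F"
    by (simp add: finite_Basis)
  have "orbit_form sc \<rho> (L i) w \<in> forms.span ?F" if "i \<in> {1..h}" for i w
  proof -
    interpret O: Vector_Spaces.linear sc "fun_scale sc" "orbit_form sc \<rho> (L i)"
      by (rule linear_orbit_form)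
    have "w \<in> span basis_W"
      by (simp add: span_Basis)
    then have "orbit_form sc \<rho> (L i) w \<in> forms.span (orbit_form sc \<rho> (L i) ` basis_W)"
      unfolding O.span_image by blast
    then show ?thesis
      using forms.span_mono[of "orbit_form sc \<rho> (L i) ` basis_W" ?F] that by blast
  qed
  then have span: "M\<^sub>W \<subseteq> forms.span ?F"
    using split by (metis (no_types, lifting) forms.span_sum subsetI)
  note M = subspace_forms fin span
  have "forms.trace_on M\<^sub>W (hecke A) =
      (\<Sum>i=1..h. 1 * forms.trace_on M\<^sub>W (\<lambda>f. hecke A (orbit_form sc \<rho> (L i) (f (L i)))))"
  proof (rule forms.trace_on_sum_scale[OF M])
    fix f assume f: "f \<in> M\<^sub>W"
    have "hecke A f = hecke A (\<Sum>i=1..h. orbit_form sc \<rho> (L i) (f (L i)))"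
      using split[OF f] by simp
    then show "hecke A f =
        (\<Sum>i=1..h. fun_scale sc 1 (hecke A (orbit_form sc \<rho> (L i) (f (L i)))))"
      by (simp add: T.sum)
  qed (use L in \<open>simp add: hecke_in_forms orbit_form_in_forms\<close>)
  also have "\<dots> = (\<Sum>i=1..h. trace_on UNIV (\<lambda>w. hecke A (orbit_form sc \<rho> (L i) w) (L i)))"
  proof (intro sum.cong refl)
    fix i assume i: "i \<in> {1..h}"
    interpret pair: vector_space_pair "fun_scale sc :: _ \<Rightarrow> ((real ^ 'n) set \<Rightarrow> 'w) \<Rightarrow> _" sc
      by (intro vector_space_pair.intro vector_space_axioms forms.vector_space_axioms)
    have "Vector_Spaces.linear sc (fun_scale sc) (\<lambda>w. hecke A (orbit_form sc \<rho> (L i) w))"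
      using Vector_Spaces.linear_compose[OF linear_orbit_form linear_hecke] by (simp add: o_def)
    then show "1 * forms.trace_on M\<^sub>W (\<lambda>f. hecke A (orbit_form sc \<rho> (L i) (f (L i)))) =
        trace_on UNIV (\<lambda>w. hecke A (orbit_form sc \<rho> (L i) w) (L i))"
      \<comment> \<open>The \<open>i\<close>-th summand is evaluation at \<open>L i\<close>, from
        forms to \<open>W\<close>, followed by a map back to forms; exchanging the two leaves an
        endomorphism of \<open>W\<close>.\<close>
      using pair.trace_on_cyclic[OF linear_eval[of "L i"] _ _ _ M UNIV_spanned,
          where g = "\<lambda>w. hecke A (orbit_form sc \<rho> (L i) w)"] L i
      by (simp add: hecke_in_forms orbit_form_in_forms image_subset_iff)
  qed
  finally show ?thesis .
qed

text \<open>The Hecke operator sums the orbit form over the neighbours of \<open>K\<close>. Its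
  support is the class of \<open>K\<close>, so only isometric neighbours count, and these are
  grouped by orbits.\<close>

lemma trace_hecke_orbit_form:
  assumes K: "K \<in> even_lattices" and A: "group A" "finite (carrier A)"
    and g: "\<And>j. j \<in> J \<Longrightarrow> g j \<in> SO"
    and V: "\<And>j. j \<in> J \<Longrightarrow> V j = SO_stab_orbit K (act (g j) K)"
    and disj: "disjoint_family_on V J"
    and cover: "isometric_neighbours A K = (\<Union>j\<in>J. V j)"
  shows "trace_on UNIV (\<lambda>w. hecke A (orbit_form sc \<rho> K w) K) =
    1 / of_nat (card (SO_stab K)) *
      (\<Sum>j\<in>J. of_nat (card (V j)) * (\<Sum>\<gamma>\<in>SO_stab K. trace_on UNIV (\<rho> (\<gamma> ** g j))))"
proof -
  have fin: "finite (neighbours A K)"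
    by (rule finite_neighbours[OF K A])
  then have finV: "finite (\<Union>j\<in>J. V j)"
    unfolding cover[symmetric] by (simp add: isometric_neighbours_def)
  \<comment> \<open>Nonempty disjoint orbits are pairwise distinct, so \<open>V\<close> is injective
    on \<open>J\<close>; finiteness of their union then forces \<open>J\<close> to be
    finite.\<close>
  have ne: "V j \<noteq> {}" if "j \<in> J" for j
    using V[OF that] SO_stab_one[of K] by (auto simp: SO_stab_orbit_def)
  then have "inj_on V J"
    using disj by (force simp: disjoint_family_on_def inj_on_def)
  moreover have "finite (V ` J)"
    using finV by (rule finite_UnionD)
  ultimately have finJ: "finite J"
    by (rule finite_imageD[rotated])
  let ?tr = "\<lambda>M. trace_on UNIV (\<lambda>w. orbit_form sc \<rho> K w M)"
  let ?c = "1 / of_nat (card (SO_stab K)) :: complex"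
  let ?s = "\<lambda>j. \<Sum>\<gamma>\<in>SO_stab K. trace_on UNIV (\<rho> (\<gamma> ** g j))"
  have "trace_on UNIV (\<lambda>w. hecke A (orbit_form sc \<rho> K w) K) = (\<Sum>M\<in>neighbours A K. 1 * ?tr M)"
    using K by (intro trace_on_sum_scale[OF UNIV_spanned]) (auto simp: hecke_def)
  also have "\<dots> = (\<Sum>M\<in>isometric_neighbours A K. ?tr M)"
  proof (rule sum.mono_neutral_cong_right[OF fin])
    show "\<forall>M\<in>neighbours A K - isometric_neighbours A K. 1 * ?tr M = 0"
    proof
      fix M assume "M \<in> neighbours A K - isometric_neighbours A K"
      then have "orbit_form sc \<rho> K w M = 0" for w
        by (intro orbit_form_off_class) (auto simp: isometric_neighbours_def SO_class_def)
      then show "1 * ?tr M = 0"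
        \<comment> \<open>The instance with empty index set: the zero map has trace 0.\<close>
        using trace_on_sum_scale[OF UNIV_spanned, of "\<lambda>_. 0" "\<lambda>_. 0" _ "{}"] by simp
    qed
  qed (auto simp: isometric_neighbours_def)
  also have "\<dots> = (\<Sum>j\<in>J. \<Sum>M\<in>V j. ?tr M)"
    unfolding cover using finJ finV disj
    by (intro sum.UNION_disjoint) (auto simp: disjoint_family_on_def intro: finite_subset)
  \<comment> \<open>The inner summand no longer depends on \<open>M\<close>, which produces the
    factor \<open>card (V j)\<close>.\<close>
  also have "\<dots> = (\<Sum>j\<in>J. \<Sum>M\<in>V j. ?c * ?s j)"
    using trace_orbit_form[OF g] V by (intro sum.cong refl) blast
  also have "\<dots> = ?c * (\<Sum>j\<in>J. of_nat (card (V j)) * ?s j)"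
    by (simp add: sum_distrib_left mult_ac)
  finally show ?thesis .
qed

end

theorem proposition3p1p2:
  fixes sc :: "complex \<Rightarrow> 'w::ab_group_add \<Rightarrow> 'w"
    and basis_W :: "'w set"
    and \<rho> :: "real ^ 'n::finite ^ 'n \<Rightarrow> 'w \<Rightarrow> 'w"
    and A :: "'a monoid"
    and h :: nat
    and L :: "nat \<Rightarrow> (real ^ 'n) set"
  assumes n: "CARD('n) mod 8 \<in> {0, 1, 7}"
    and W: "finite_dimensional_vector_space sc basis_W"
    and \<rho>: "SO_representation sc \<rho>"
    and A: "comm_group A" "finite (carrier A)"
    and L: "\<forall>i\<in>{1..h}. L i \<in> even_lattices"
    and reps: "bij_betw (\<lambda>i. SO_class (L i)) {1..h} lattice_classes"
  shows "(\<forall>i\<in>{1..h}. \<forall>\<gamma>\<in>SO_stab (L i). \<forall>M\<in>isometric_neighbours A (L i).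
            act \<gamma> M \<in> isometric_neighbours A (L i)) \<and>
         (\<forall>(J :: nat \<Rightarrow> 'j set) (g :: nat \<Rightarrow> 'j \<Rightarrow> real ^ 'n ^ 'n) V.
            (\<forall>i\<in>{1..h}.
               (\<forall>j\<in>J i. g i j \<in> SO \<and> V i j = SO_stab_orbit (L i) (act (g i j) (L i))) \<and>
               disjoint_family_on (V i) (J i) \<and>
               isometric_neighbours A (L i) = (\<Union>j\<in>J i. V i j)) \<longrightarrow>
            vector_space.trace_on (fun_scale sc) (automorphic_forms \<rho>) (hecke A) =
              (\<Sum>i = 1..h. 1 / of_nat (card (SO_stab (L i))) *
                 (\<Sum>j\<in>J i. of_nat (card (V i j)) *
                    (\<Sum>\<gamma>\<in>SO_stab (L i).
                       vector_space.trace_on sc UNIV (\<rho> (\<gamma> ** g i j))))))"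
proof -
  interpret SO_rep sc basis_W \<rho>
    using W \<rho> by (intro SO_rep.intro SO_rep_axioms.intro)
  interpret A: comm_group A by fact
  show ?thesis
  proof (intro conjI allI impI ballI)
    fix i \<gamma> M
    assume "i \<in> {1..h}" "\<gamma> \<in> SO_stab (L i)" "M \<in> isometric_neighbours A (L i)"
    then show "act \<gamma> M \<in> isometric_neighbours A (L i)"
      using L isometric_neighbours_act by blast
  next
    fix J :: "nat \<Rightarrow> 'j set" and g :: "nat \<Rightarrow> 'j \<Rightarrow> real ^ 'n ^ 'n" and V
    assume *: "\<forall>i\<in>{1..h}.
      (\<forall>j\<in>J i. g i j \<in> SO \<and> V i j = SO_stab_orbit (L i) (act (g i j) (L i))) \<and>
      disjoint_family_on (V i) (J i) \<and>
      isometric_neighbours A (L i) = (\<Union>j\<in>J i. V i j)"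
    show "vector_space.trace_on (fun_scale sc) (automorphic_forms \<rho>) (hecke A) =
      (\<Sum>i = 1..h. 1 / of_nat (card (SO_stab (L i))) *
        (\<Sum>j\<in>J i. of_nat (card (V i j)) *
          (\<Sum>\<gamma>\<in>SO_stab (L i). vector_space.trace_on sc UNIV (\<rho> (\<gamma> ** g i j)))))"
      \<comment> \<open>Both sides become sums over the classes, and they agree term by
        term.\<close>
      unfolding trace_hecke[OF L reps]
    proof (intro sum.cong refl trace_hecke_orbit_form A.is_group A(2))
    qed (use L * in blast)+
  qed
qed

end
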